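(* Let $(\mathcal{Z},\mathsf{d})$ be a compact metric space, let $D\ge 1$ be an integer, and let $\mathbb{S}^{D-1}=\{x\in\mathbb{R}^D:\|x\|_2=1\}$. Let $\phi:\mathcal{Z}\to\mathbb{S}^{D-1}$ be a continuous injective map, with image $\mathcal{M}=\phi(\mathcal{Z})$. Suppose there exist a twice continuously differentiable function $g:[0,\infty)\to\mathbb{R}$ (derivatives at $0$ being one-sided) with $g'(0)<0$ and a real number $\epsilon>0$ such that $$\mathrm{CosSim}\left(\phi(z),\phi(z')\right)=g\left(\mathsf{d}(z,z')^2\right)\quad\text{for all } z,z'\in\mathcal{Z}\text{ with }\mathsf{d}(z,z')\le\epsilon.$$ Let $\eta:[a,b]\to\mathcal{Z}$ be a path of finite length, and let $\gamma=\phi\circ\eta:[a,b]\to\mathcal{M}$ be the corresponding path on $\mathcal{M}$. Then $$L(\gamma)=\sqrt{-2g'(0)}\;L(\eta),$$ where $L(\eta)$ is the length of $\eta$ with respect to $\mathsf{d}$ and $L(\gamma)$ is the length of $\gamma$ with respect to the Euclidean distance on $\mathbb{R}^D$.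
   Context: For nonzero $u,v\in\mathbb{R}^D$, $\mathrm{CosSim}(u,v)=\langle u,v\rangle/(\|u\|_2\|v\|_2)$; for unit vectors this is $\langle u,v\rangle$. A path in $\mathcal{Z}$ is a continuous map $\eta:[a,b]\to\mathcal{Z}$ from some interval $[a,b]$. Its length is $$L(\eta)=\sup_{\mathcal{T}}\sum_{i=1}^n\mathsf{d}(\eta_{t_i},\eta_{t_{i-1}}),$$ where the supremum is over all $n\ge1$ and all $\mathcal{T}=(t_0,\ldots,t_n)$ with $t_0=a\le t_1\le\cdots\le t_n=b$. The path has finite length if $L(\eta)<\infty$. The length of a path $\gamma:[a,b]\to\mathcal{M}\subseteq\mathbb{R}^D$ is $$L(\gamma)=\sup_{\mathcal{T}}\sum_{i=1}^n\|\gamma_{t_i}-\gamma_{t_{i-1}}\|_2,$$ with the supremum over the same collection of $\mathcal{T}$. *)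

theory Defs
  imports "HOL-Analysis.Analysis"
begin

definition cos_sim :: "'a::real_inner \<Rightarrow> 'a \<Rightarrow> real" where
  "cos_sim u v = (u \<bullet> v) / (norm u * norm v)"

text \<open>A subdivision \<open>t\<^sub>0 = a \<le> t\<^sub>1 \<le> \<dots> \<le> t\<^sub>n = b\<close> is a function on \<open>nat\<close>, of which only the values
  at \<open>0, \<dots>, n\<close> are constrained.\<close>

definition subdivision :: "real \<Rightarrow> real \<Rightarrow> nat \<Rightarrow> (nat \<Rightarrow> real) \<Rightarrow> bool" where
  "subdivision a b n t \<longleftrightarrow>
     n \<ge> 1 \<and> t 0 = a \<and> t n = b \<and> (\<forall>i\<in>{1..n}. t (i - 1) \<le> t i)"

text \<open>The length takes the distance function as a parameter. It is extended-real valued, since a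
  continuous path may have infinite length.\<close>

definition path_length :: "('a \<Rightarrow> 'a \<Rightarrow> real) \<Rightarrow> real \<Rightarrow> real \<Rightarrow> (real \<Rightarrow> 'a) \<Rightarrow> ereal" where
  "path_length d a b p =
     Sup {ereal (\<Sum>i=1..n. d (p (t i)) (p (t (i - 1)))) | n t. subdivision a b n t}"

end

theory Submission
  imports Defs
begin

text \<open>For nearby points \<open>\<parallel>\<phi> z - \<phi> z'\<parallel>\<^sup>2 = 2 - 2 g (d\<^sup>2)\<close> with \<open>g 0 = 1\<close>, so
  \<open>\<parallel>\<phi> z - \<phi> z'\<parallel> / d \<longlongrightarrow> sqrt (- 2 g' 0)\<close> uniformly as \<open>d \<longlongrightarrow> 0\<close>. By the
  triangle inequality, refining a subdivision does not decrease its polygonal sum, so a comparison of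
  the two distances at small scale passes to the lengths.\<close>

section \<open>Subdivisions, their refinement and comparison of path lengths\<close>

lemma path_length_lessThan:
  "path_length d a b p = Sup {ereal (\<Sum>i<n. d (p (t (Suc i))) (p (t i))) | n t. subdivision a b n t}"
  unfolding path_length_def by (simp add: sum.atLeast1_atMost_eq)

lemma subdivision_alt:
  "subdivision a b n t \<longleftrightarrow> n \<ge> 1 \<and> t 0 = a \<and> t n = b \<and> (\<forall>i<n. t i \<le> t (Suc i))"
proof -
  have "(\<forall>i\<in>{1..n}. t (i - 1) \<le> t i) \<longleftrightarrow> (\<forall>i<n. t i \<le> t (Suc i))"
    by (metis One_nat_def Suc_le_eq Suc_pred atLeastAtMost_iff diff_Suc_1 le_add1 plus_1_eq_Suc)
  then show ?thesis by (simp add: subdivision_def)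
qed

lemma subdivision_mono:
  assumes "subdivision a b n t" "i \<le> j" "j \<le> n"
  shows "t i \<le> t j"
  using assms(2,3)
proof (induction j rule: dec_induct)
  case (step k)
  then have "t k \<le> t (Suc k)" using assms(1) by (simp add: subdivision_alt)
  with step show ?case by simp
qed simp

lemma subdivision_in_range:
  assumes "subdivision a b n t" "i \<le> n"
  shows "t i \<in> {a..b}"
  using subdivision_mono[OF assms(1), of 0 i] subdivision_mono[OF assms(1), of i n] assms
  by (simp add: subdivision_alt)

text \<open>The assumptions on \<open>d\<close> are confined to a set \<open>S\<close>, so that the
  lemma serves both \<open>dist\<close> on the whole space and a metric known only on its
  carrier.\<close>

lemma polygonal_triangle:
  fixes d :: "'a \<Rightarrow> 'a \<Rightarrow> real"
  assumes "\<And>x y z. x \<in> S \<Longrightarrow> y \<in> S \<Longrightarrow> z \<in> S \<Longrightarrow> d x z \<le> d x y + d y z"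
    and "\<And>x. x \<in> S \<Longrightarrow> d x x = 0" and "\<And>j. j \<le> N \<Longrightarrow> q j \<in> S"
  shows "d (q N) (q 0) \<le> (\<Sum>j<N. d (q (Suc j)) (q j))"
  using assms(3)
proof (induction N)
  case 0
  then show ?case using assms(2) by simp
next
  case (Suc N)
  have "d (q (Suc N)) (q 0) \<le> d (q (Suc N)) (q N) + d (q N) (q 0)"
    by (rule assms(1)) (simp_all add: Suc.prems)
  then show ?case using Suc by fastforce
qed

text \<open>Each interval of the subdivision is cut into \<open>N\<close> equal parts, so that the sums regroup into
  blocks of length \<open>N\<close>.\<close>

definition refine :: "nat \<Rightarrow> (nat \<Rightarrow> real) \<Rightarrow> nat \<Rightarrow> real" where
  "refine N t k = t (k div N) + real (k mod N) / real N * (t (Suc (k div N)) - t (k div N))"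

text \<open>The value \<open>j = N\<close> is included so that consecutive blocks agree at their
  common endpoint: there \<open>div\<close> has moved on to \<open>Suc i\<close> and
  \<open>mod\<close> is back to 0, yet the interpolation formula of block \<open>i\<close> still
  gives \<open>t (Suc i)\<close>.\<close>

lemma refine_block:
  assumes "N \<ge> 1" "j \<le> N"
  shows "refine N t (i * N + j) = t i + real j / real N * (t (Suc i) - t i)"
proof (cases "j = N")
  case True
  have "refine N t (i * N + j) = refine N t (Suc i * N)"
    using True by (simp add: add.commute)
  also have "\<dots> = t (Suc i)"
    unfolding refine_def using assms by (metis add_cancel_right_right div_by_0 mod_mult_self2_is_0
        mult_zero_left nonzero_mult_div_cancel_right not_one_le_zero of_nat_0 div_0)
  finally show ?thesis using True assms by simp
next
  case False
  then show ?thesis using assms by (simp add: refine_def)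
qed

lemma refine_Suc:
  assumes "N \<ge> 1"
  shows "refine N t (Suc k) - refine N t k = (t (Suc (k div N)) - t (k div N)) / real N"
proof -
  define i j where "i = k div N" and "j = k mod N"
  have k: "k = i * N + j" and j: "j < N"
    using assms by (simp_all add: i_def j_def)
  \<comment> \<open>\<open>Suc j\<close> may equal \<open>N\<close>, which
    \<open>refine_block\<close> allows, so the last increment of a block needs no separate
    case.\<close>
  have "refine N t (i * N + Suc j) - refine N t (i * N + j) = (t (Suc i) - t i) / real N"
    using assms j refine_block[OF assms, of "Suc j" t i] refine_block[OF assms, of j t i]
    by (simp add: add_divide_distrib diff_divide_distrib distrib_right)
  then show ?thesis by (simp only: add_Suc_right k[symmetric] i_def[symmetric])
qed

lemma subdivision_refine:
  assumes "subdivision a b n t" "N \<ge> 1"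
  shows "subdivision a b (n * N) (refine N t)"
proof -
  have "refine N t k \<le> refine N t (Suc k)" if "k < n * N" for k
  proof -
    have "k div N < n" using that assms by (simp add: less_mult_imp_div_less)
    then have "0 \<le> (t (Suc (k div N)) - t (k div N)) / real N"
      using assms by (simp add: subdivision_alt)
    then show ?thesis using refine_Suc[OF assms(2), of t k] by linarith
  qed
  moreover have "refine N t 0 = a" "refine N t (n * N) = b"
    using refine_block[OF assms(2), of 0 t 0] refine_block[OF assms(2), of 0 t n] assms
    by (simp_all add: subdivision_alt)
  moreover have "n * N \<ge> 1" using assms by (simp add: subdivision_alt Suc_le_eq)
  ultimately show ?thesis by (simp add: subdivision_alt)
qed

lemma refine_mesh:
  assumes "subdivision a b n t" "N \<ge> 1" "k < n * N"
  shows "refine N t (Suc k) - refine N t k \<le> (b - a) / real N"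
proof -
  have "k div N < n" using assms by (simp add: less_mult_imp_div_less)
  \<comment> \<open>An interval of the original subdivision lies in \<open>{a..b}\<close>, so its
    length is at most \<open>b - a\<close>.\<close>
  then have "t (Suc (k div N)) \<in> {a..b}" "t (k div N) \<in> {a..b}"
    using assms subdivision_in_range by (meson Suc_leI less_imp_le)+
  then show ?thesis
    using refine_Suc[OF assms(2), of t k] by (simp add: divide_right_mono)
qed

text \<open>Each original step is bounded by the sum over the \<open>N\<close> steps of its block,
  by the triangle inequality; adding the blocks gives the refined sum.\<close>

lemma polygonal_refine:
  fixes d :: "'a \<Rightarrow> 'a \<Rightarrow> real"
  assumes "\<And>x y z. x \<in> S \<Longrightarrow> y \<in> S \<Longrightarrow> z \<in> S \<Longrightarrow> d x z \<le> d x y + d y z"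
    and "\<And>x. x \<in> S \<Longrightarrow> d x x = 0" and "p ` {a..b} \<subseteq> S"
    and t: "subdivision a b n t" and N: "N \<ge> 1"
  shows "(\<Sum>i<n. d (p (t (Suc i))) (p (t i)))
       \<le> (\<Sum>k<n * N. d (p (refine N t (Suc k))) (p (refine N t k)))"
proof -
  let ?q = "\<lambda>k. p (refine N t k)"
  have "d (p (t (Suc i))) (p (t i)) \<le> (\<Sum>k=i * N..<i * N + N. d (?q (Suc k)) (?q k))" if "i < n" for i
  proof -
    have "?q (i * N + j) \<in> S" if "j \<le> N" for j
    proof -
      have "i * N + j \<le> n * N"
        using \<open>i < n\<close> that by (metis Suc_leI add.commute add_le_cancel_left le_trans mult_Suc mult_le_mono1)
      then show ?thesis
        using subdivision_in_range[OF subdivision_refine[OF t N]] assms(3) by blast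
    qed
    from polygonal_triangle[where q = "\<lambda>j. ?q (i * N + j)", OF assms(1,2) this]
    have "d (?q (i * N + N)) (?q (i * N + 0)) \<le> (\<Sum>j<N. d (?q (i * N + Suc j)) (?q (i * N + j)))"
      by simp
    also have "\<dots> = (\<Sum>k=i * N..<i * N + N. d (?q (Suc k)) (?q k))"
      using sum.shift_bounds_nat_ivl[of "\<lambda>k. d (?q (Suc k)) (?q k)" 0 "i * N" N]
      by (simp add: add.commute lessThan_atLeast0)
    finally show ?thesis
      using refine_block[OF N, of N t i] refine_block[OF N, of 0 t i] N by simp
  qed
  then have "(\<Sum>i<n. d (p (t (Suc i))) (p (t i)))
      \<le> (\<Sum>i<n. \<Sum>k=i * N..<i * N + N. d (?q (Suc k)) (?q k))"
    by (intro sum_mono) simp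
  then show ?thesis by (simp add: sum.nat_group)
qed

text \<open>Refine an arbitrary subdivision until its mesh is below \<open>\<rho>\<close>. The
  \<open>d1\<close> sum does not decrease, and each of its terms is now controlled by
  \<open>loc\<close>, so it is at most \<open>K\<close> times a \<open>d2\<close> sum. The theorem
  uses this in both directions between \<open>d\<close> and \<open>dist\<close>.\<close>

lemma path_length_le_local:
  fixes d1 :: "'a \<Rightarrow> 'a \<Rightarrow> real" and d2 :: "'b \<Rightarrow> 'b \<Rightarrow> real"
  assumes tri: "\<And>x y z. x \<in> S \<Longrightarrow> y \<in> S \<Longrightarrow> z \<in> S \<Longrightarrow> d1 x z \<le> d1 x y + d1 y z"
    and refl: "\<And>x. x \<in> S \<Longrightarrow> d1 x x = 0" and p: "p ` {a..b} \<subseteq> S"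
    and "K \<ge> 0" and "\<rho> > 0"
    and loc: "\<And>s t. s \<in> {a..b} \<Longrightarrow> t \<in> {a..b} \<Longrightarrow> \<bar>t - s\<bar> < \<rho> \<Longrightarrow> d1 (p t) (p s) \<le> K * d2 (q t) (q s)"
  shows "path_length d1 a b p \<le> ereal K * path_length d2 a b q"
proof -
  have "ereal (\<Sum>i<n. d1 (p (t (Suc i))) (p (t i))) \<le> ereal K * path_length d2 a b q"
    if t: "subdivision a b n t" for n t
  proof -
    obtain N :: nat where N: "N \<ge> 1" "(b - a) / real N < \<rho>"
    proof -
      obtain M :: nat where "b - a < real M * \<rho>"
        using reals_Archimedean3[OF \<open>\<rho> > 0\<close>] by blast
      then have "(b - a) / real (Suc M) < \<rho>"
        using \<open>\<rho> > 0\<close> by (simp add: divide_simps algebra_simps)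
      then show ?thesis using that[of "Suc M"] by simp
    qed
    let ?u = "refine N t"
    have u: "subdivision a b (n * N) ?u" by (rule subdivision_refine[OF t N(1)])
    have "(\<Sum>i<n. d1 (p (t (Suc i))) (p (t i))) \<le> (\<Sum>k<n * N. d1 (p (?u (Suc k))) (p (?u k)))"
      by (rule polygonal_refine[OF tri refl p t N(1)])
    also have "\<dots> \<le> (\<Sum>k<n * N. K * d2 (q (?u (Suc k))) (q (?u k)))"
    proof (intro sum_mono loc)
      fix k assume "k \<in> {..<n * N}"
      then have k: "k < n * N" by simp
      then show "?u k \<in> {a..b}" "?u (Suc k) \<in> {a..b}"
        using subdivision_in_range[OF u] by simp_all
      have "?u k \<le> ?u (Suc k)" using u k by (simp add: subdivision_alt)
      then show "\<bar>?u (Suc k) - ?u k\<bar> < \<rho>" using refine_mesh[OF t N(1) k] N(2) by linarith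
    qed
    finally have "ereal (\<Sum>i<n. d1 (p (t (Suc i))) (p (t i)))
        \<le> ereal K * ereal (\<Sum>k<n * N. d2 (q (?u (Suc k))) (q (?u k)))"
      by (simp add: sum_distrib_left)
    also have "\<dots> \<le> ereal K * path_length d2 a b q"
      unfolding path_length_lessThan using u \<open>K \<ge> 0\<close>
      by (intro ereal_mult_left_mono Sup_upper) auto
    finally show ?thesis .
  qed
  then show ?thesis
    unfolding path_length_lessThan[of d1] by (intro Sup_least) auto
qed

text \<open>The subdivision with the single interval from \<open>a\<close> to \<open>b\<close>
  already gives a nonnegative sum. With finiteness, this makes the length of \<eta> a real
  number.\<close>

lemma path_length_nonneg:
  assumes "a \<le> b" "\<And>x y. d x y \<ge> 0"
  shows "path_length d a b p \<ge> 0"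
proof -
  define t where "t = (\<lambda>i::nat. if i = 0 then a else b)"
  have "subdivision a b 1 t"
    using assms by (simp add: subdivision_def t_def)
  then have "ereal (\<Sum>i=1..1. d (p (t i)) (p (t (i - 1)))) \<le> path_length d a b p"
    unfolding path_length_def by (intro Sup_upper) blast
  moreover have "0 \<le> ereal (\<Sum>i=1..1. d (p (t i)) (p (t (i - 1))))"
    using assms(2) by simp
  ultimately show ?thesis by (rule order_trans[rotated])
qed

section \<open>Chord length against distance at small scale\<close>

lemma dist_unit_sq_cos_sim:
  fixes u v :: "'a::real_inner"
  assumes "norm u = 1" "norm v = 1"
  shows "(dist u v)\<^sup>2 = 2 - 2 * cos_sim u v"
  by (simp add: assms cos_sim_def dist_norm dot_norm_neg[of u v] diff_divide_distrib)

text \<open>Here \<open>x\<close> is a distance in \<open>Z\<close> and \<open>y\<close> the chord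
  length. For \<open>x > 0\<close> the quotient \<open>y\<^sup>2 / x\<^sup>2\<close> is -2 times the
  difference quotient of \<open>g\<close> between 0 and \<open>x\<^sup>2\<close>, so it tends to
  \<open>- 2 * m\<close>, strictly between \<open>A\<^sup>2\<close> and
  \<open>B\<^sup>2\<close>.\<close>

lemma chord_bounds:
  fixes g :: "real \<Rightarrow> real"
  assumes der: "(g has_real_derivative m) (at 0 within {0..})" and "g 0 = 1"
    and AB: "0 < A" "A < sqrt (- 2 * m)" "sqrt (- 2 * m) < B"
  obtains r where "r > 0"
    "\<And>x y. 0 \<le> x \<Longrightarrow> x < r \<Longrightarrow> 0 \<le> y \<Longrightarrow> y\<^sup>2 = 2 - 2 * g (x\<^sup>2) \<Longrightarrow> A * x \<le> y \<and> y \<le> B * x"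
proof -
  have "((\<lambda>x. (g x - 1) / x) \<longlongrightarrow> m) (at_right 0)"
    using der \<open>g 0 = 1\<close> unfolding has_field_derivative_iff
    by (auto intro: tendsto_within_subset)
  then have lim: "((\<lambda>x. - 2 * ((g x - 1) / x)) \<longlongrightarrow> - 2 * m) (at_right 0)"
    by (intro tendsto_intros)
  \<comment> \<open>This forces \<open>- 2 * m > 0\<close>, since \<open>sqrt\<close> is negative at
    negative arguments; hence squaring the root returns \<open>- 2 * m\<close>.\<close>
  have "sqrt (- 2 * m) > 0" using AB by linarith
  then have "(sqrt (- 2 * m))\<^sup>2 = - 2 * m" by simp
  then have "A\<^sup>2 < - 2 * m" "- 2 * m < B\<^sup>2"
    using power_strict_mono[OF AB(2), of 2] power_strict_mono[OF AB(3), of 2] AB(1)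
      \<open>sqrt (- 2 * m) > 0\<close> by linarith+
  then have "\<forall>\<^sub>F x in at_right 0. A\<^sup>2 < - 2 * ((g x - 1) / x) \<and> - 2 * ((g x - 1) / x) < B\<^sup>2"
    using order_tendstoD[OF lim] by (intro eventually_conj) auto
  then obtain s where s: "s > 0"
    "\<And>x. 0 < x \<Longrightarrow> x < s \<Longrightarrow> A\<^sup>2 < - 2 * ((g x - 1) / x) \<and> - 2 * ((g x - 1) / x) < B\<^sup>2"
    unfolding eventually_at_right_field by auto
  \<comment> \<open>The radius is \<open>sqrt s\<close> because the quotient is evaluated at
    \<open>x\<^sup>2\<close>. The one-sided limit says nothing at \<open>x = 0\<close>, where
    \<open>g 0 = 1\<close> gives \<open>y = 0\<close>.\<close>
  have "A * x \<le> y \<and> y \<le> B * x"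
    if x: "0 \<le> x" "x < sqrt s" and y: "0 \<le> y" "y\<^sup>2 = 2 - 2 * g (x\<^sup>2)" for x y
  proof (cases "x = 0")
    case True
    then show ?thesis using y \<open>g 0 = 1\<close> by simp
  next
    case False
    then have "0 < x\<^sup>2" "x\<^sup>2 < s"
      using power_strict_mono[OF x(2,1), of 2] s(1) by simp_all
    note s(2)[OF this]
    then have "(A * x)\<^sup>2 \<le> y\<^sup>2" "y\<^sup>2 \<le> (B * x)\<^sup>2"
      using \<open>0 < x\<^sup>2\<close> y(2) by (simp_all add: field_simps power_mult_distrib)
    moreover have "0 \<le> B * x" using AB x(1) by simp
    ultimately show ?thesis
      using y(1) power2_le_imp_le by blast
  qed
  then show ?thesis using that[of "sqrt s"] s(1) by simp
qed

text \<open>Heine-Cantor on the compact interval, viewed as a submetric of the real line.\<close>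

lemma path_uniformly_continuous:
  fixes \<eta> :: "real \<Rightarrow> 'a"
  assumes "Metric_space Z d" and "continuous_map (top_of_set {a..b}) (Metric_space.mtopology Z d) \<eta>"
    and "r > 0"
  obtains \<rho> where "\<rho> > 0"
    "\<And>s t. s \<in> {a..b} \<Longrightarrow> t \<in> {a..b} \<Longrightarrow> \<bar>t - s\<bar> < \<rho> \<Longrightarrow> d (\<eta> t) (\<eta> s) < r"
proof -
  interpret Metric_space Z d by fact
  let ?I = "submetric euclidean_metric {a..b}"
  have I: "mtopology_of ?I = top_of_set {a..b}"
    by (simp add: mtopology_of_submetric)
  have "compact_space (top_of_set {a..b})"
    by (simp add: compact_space_subtopology)
  then have "uniformly_continuous_map ?I (metric (Z, d)) \<eta>"
    using assms(2) I by (intro continuous_imp_uniformly_continuous_map) simp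
  then obtain \<rho> where "\<rho> > 0" "\<forall>s\<in>{a..b}. \<forall>t\<in>{a..b}. dist t s < \<rho> \<longrightarrow> d (\<eta> t) (\<eta> s) < r"
    using \<open>r > 0\<close> by (auto simp: uniformly_continuous_map_def)
  then show ?thesis by (intro that[of \<rho>]) (auto simp: dist_real_def)
qed

section \<open>Equality of the two lengths\<close>

theorem theorem1:
  fixes Z :: "'a set" and d :: "'a \<Rightarrow> 'a \<Rightarrow> real"
    and \<phi> :: "'a \<Rightarrow> real ^ 'n"
    and g g' g'' :: "real \<Rightarrow> real"
    and \<epsilon> a b :: real
    and \<eta> :: "real \<Rightarrow> 'a" and \<gamma> :: "real \<Rightarrow> real ^ 'n"
  assumes "Metric_space Z d"
    and "compact_space (Metric_space.mtopology Z d)"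
    and "continuous_map (Metric_space.mtopology Z d) (top_of_set (sphere 0 1)) \<phi>"
    and "inj_on \<phi> Z"
    and "\<And>x. x \<ge> 0 \<Longrightarrow> (g has_real_derivative g' x) (at x within {0..})"
    and "\<And>x. x \<ge> 0 \<Longrightarrow> (g' has_real_derivative g'' x) (at x within {0..})"
    and "continuous_on {0..} g''"
    and "g' 0 < 0"
    and "\<epsilon> > 0"
    and "\<And>z z'. z \<in> Z \<Longrightarrow> z' \<in> Z \<Longrightarrow> d z z' \<le> \<epsilon> \<Longrightarrow>
           cos_sim (\<phi> z) (\<phi> z') = g ((d z z')\<^sup>2)"
    and "a \<le> b"
    and "continuous_map (top_of_set {a..b}) (Metric_space.mtopology Z d) \<eta>"
    and "path_length d a b \<eta> < \<infinity>"
    and "\<gamma> = \<phi> \<circ> \<eta>"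
  shows "path_length dist a b \<gamma> = ereal (sqrt (- 2 * g' 0)) * path_length d a b \<eta>"
proof -
  interpret Metric_space Z d by fact
  let ?c = "sqrt (- 2 * g' 0)"
  have c: "?c > 0" using assms(8) by simp
  have \<phi>: "norm (\<phi> z) = 1" if "z \<in> Z" for z
    using continuous_map_image_subset_topspace[OF assms(3)] that by auto
  have \<eta>: "\<eta> ` {a..b} \<subseteq> Z"
    using continuous_map_image_subset_topspace[OF assms(12)] by simp
  then have "\<eta> a \<in> Z" using assms(11) by auto
  \<comment> \<open>Compare the point \<open>\<eta> a\<close> with itself: its distance is 0 and its
    cosine similarity is 1.\<close>
  then have g0: "g 0 = 1"
    using assms(10)[of "\<eta> a" "\<eta> a"] \<phi>[of "\<eta> a"] assms(9)
    by (simp add: cos_sim_def dot_square_norm)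
  obtain l where l: "path_length d a b \<eta> = ereal l"
    using path_length_nonneg[OF assms(11), of d \<eta>] assms(13)
    by (cases "path_length d a b \<eta>") auto
  \<comment> \<open>The constants are kept strictly on either side of \<open>?c\<close>, where the
    comparison holds at a fixed positive scale; they are sent to \<open>?c\<close> at the
    end.\<close>
  have bounds: "ereal (A * l) \<le> path_length dist a b \<gamma> \<and> path_length dist a b \<gamma> \<le> ereal (B * l)"
    if AB: "0 < A" "A < ?c" "?c < B" for A B
  proof -
    obtain r where r: "r > 0"
      "\<And>x y. 0 \<le> x \<Longrightarrow> x < r \<Longrightarrow> 0 \<le> y \<Longrightarrow> y\<^sup>2 = 2 - 2 * g (x\<^sup>2) \<Longrightarrow> A * x \<le> y \<and> y \<le> B * x"
      using chord_bounds[OF assms(5)[of 0] g0 AB] by auto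
    \<comment> \<open>Distances below \<open>r\<close> admit the chord bounds, and distances below
      \<epsilon> admit the formula for the cosine similarity.\<close>
    obtain \<rho> where \<rho>: "\<rho> > 0"
      "\<And>s t. s \<in> {a..b} \<Longrightarrow> t \<in> {a..b} \<Longrightarrow> \<bar>t - s\<bar> < \<rho> \<Longrightarrow> d (\<eta> t) (\<eta> s) < min r \<epsilon>"
      using path_uniformly_continuous[OF assms(1,12), of "min r \<epsilon>"] r(1) assms(9) by auto
    have loc: "A * d (\<eta> t) (\<eta> s) \<le> dist (\<gamma> t) (\<gamma> s) \<and> dist (\<gamma> t) (\<gamma> s) \<le> B * d (\<eta> t) (\<eta> s)"
      if "s \<in> {a..b}" "t \<in> {a..b}" "\<bar>t - s\<bar> < \<rho>" for s t
    proof (rule r(2))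
      have Z: "\<eta> s \<in> Z" "\<eta> t \<in> Z" using \<eta> that by auto
      have small: "d (\<eta> t) (\<eta> s) < min r \<epsilon>" by (rule \<rho>(2)[OF that])
      then show "d (\<eta> t) (\<eta> s) < r" by simp
      show "(dist (\<gamma> t) (\<gamma> s))\<^sup>2 = 2 - 2 * g ((d (\<eta> t) (\<eta> s))\<^sup>2)"
        using dist_unit_sq_cos_sim[OF \<phi> \<phi>, OF Z(2,1)] assms(10)[OF Z(2,1)] small assms(14) by simp
    qed simp_all
    have "path_length dist a b \<gamma> \<le> ereal B * path_length d a b \<eta>"
      using loc \<rho>(1) AB c
      by (intro path_length_le_local[where S = UNIV and \<rho> = \<rho>]) (auto simp: dist_triangle)
    moreover have "path_length d a b \<eta> \<le> ereal (1 / A) * path_length dist a b \<gamma>"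
    proof (rule path_length_le_local[where S = Z and \<rho> = \<rho>])
      show "d (\<eta> t) (\<eta> s) \<le> 1 / A * dist (\<gamma> t) (\<gamma> s)"
        if "s \<in> {a..b}" "t \<in> {a..b}" "\<bar>t - s\<bar> < \<rho>" for s t
        using loc[OF that] AB(1) by (simp add: field_simps)
    qed (use \<eta> \<rho>(1) AB triangle in auto)
    ultimately show ?thesis
      using l AB(1) by (cases "path_length dist a b \<gamma>") (auto simp: field_simps)
  qed
  \<comment> \<open>Any admissible pair of constants shows that the length of \<gamma> is
    finite.\<close>
  obtain m where m: "path_length dist a b \<gamma> = ereal m"
    using bounds[of "?c / 2" "?c + 1"] c by (cases "path_length dist a b \<gamma>") auto
  \<comment> \<open>Let \<open>A\<close> increase to \<open>?c\<close> with \<open>B\<close> fixed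
    at \<open>?c + 1\<close>. The reverse inequality lets \<open>B\<close> decrease to
    \<open>?c\<close> with \<open>A\<close> fixed at \<open>?c / 2\<close>.\<close>
  have "?c * l \<le> m"
  proof (rule tendsto_upperbound)
    show "((\<lambda>A. A * l) \<longlongrightarrow> ?c * l) (at_left ?c)" by (intro tendsto_intros)
    show "\<forall>\<^sub>F A in at_left ?c. A * l \<le> m"
      using eventually_at_left_real[OF c] by eventually_elim (use bounds[of _ "?c + 1"] m in simp)
  qed simp
  moreover have "m \<le> ?c * l"
  proof (rule tendsto_lowerbound)
    show "((\<lambda>B. B * l) \<longlongrightarrow> ?c * l) (at_right ?c)" by (intro tendsto_intros)
    show "\<forall>\<^sub>F B in at_right ?c. m \<le> B * l"
      using eventually_at_right_real[OF less_add_one[of ?c]]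
      by eventually_elim (use bounds[of "?c / 2"] m c in simp)
  qed simp
  ultimately show ?thesis using m l by simp
qed

end
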